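(* Let $(A,\omega)$ be a commutative baric $K$-algebra satisfying $2x^{2}x^{4}=\omega(x)^{2}x^{4}+\omega(x)^{4}x^{2}$ for all $x\in A$, with Peirce decomposition $A=Ke\oplus A_0\oplus A_{\frac12}\oplus A_{\lambda}\oplus A_{\bar\lambda}$ relative to a non-zero idempotent $e$, and such that $A_0=0$. Let $\mu=X^2-X\in K[X]$. If $A$ is a principal train algebra of rank $n\ge4$, then its train equation is of the form $$\omega(x)^n\,\bigl((\varphi_{\bar\lambda}^{\,t}\circ\varphi_{\lambda}^{\,s}\circ\varphi_{1/2}^{\,r})(\mu)\bigr)\!\left(\frac{x}{\omega(x)}\right)=0,$$ for some integers $r\ge0$, $s\ge0$, $t\ge0$ with $r+s+t=n-2$.
   Context: $K$ is an algebraically closed (infinite, commutative) field of characteristic different from $2$. Algebras are commutative but not necessarily associative. A baric $K$-algebra $(A,\omega)$ is a $K$-algebra $A$ with a non-zero algebra homomorphism $\omega:A\to K$. Principal powers are $x^1=x$, $x^{k+1}=x\,x^{k}$. $(A,\omega)$ is a principal train algebra of rank $n\ge 2$ if there are $\gamma_1,\dots,\gamma_{n-1}\in K$ with $x^n+\gamma_1\omega(x)x^{n-1}+\dots+\gamma_{n-1}\omega(x)^{n-1}x=0$ for all $x\in A$, where $n\ge2$ is the smallest integer with this property; this equation of minimal degree is the train equation of $A$. For $\alpha\in K$, $\varphi_\alpha:K[X]\to K[X]$ is the map $P\mapsto (X-\alpha)P$, and exponents on $\varphi_\alpha$ denote iterated composition. A polynomial $P=\sum_{k\ge1}c_kX^k$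 without constant term is evaluated at $a\in A$ by $P(a)=\sum_k c_ka^k$ with principal powers; for $P$ of degree $n$, the expression $\omega(x)^nP(x/\omega(x))$ means the homogenized expression $\sum_{k=1}^n c_k\,\omega(x)^{n-k}x^k$, which makes sense for all $x\in A$. Here $\lambda=\frac{-1-i\sqrt{23}}{4}$, $\bar\lambda=\frac{-1+i\sqrt{23}}{4}$, where $i\sqrt{23}$ denotes a fixed square root of $-23$ in $K$, and for an idempotent $e$, $A_\alpha=\{x\in\ker\omega: ex=\alpha x\}$ for $\alpha\in\{0,\frac12,\lambda,\bar\lambda\}$. *)

theory Defs
  imports "HOL-Computational_Algebra.Polynomial"
begin

text \<open>
  Commutative, not necessarily associative algebras over a field, with scalar multiplication
  \<open>*s\<close> and product \<open>\<bullet>\<close>.  The carrier is the whole type.  Right bilinearity follows from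
  commutativity.
\<close>

locale comm_nonassoc_algebra = vector_space scale
  for scale :: "'k::field \<Rightarrow> 'a::ab_group_add \<Rightarrow> 'a" (infixr \<open>*s\<close> 75) +
  fixes mul :: "'a \<Rightarrow> 'a \<Rightarrow> 'a" (infixl \<open>\<bullet>\<close> 70)
  assumes mul_commute: "x \<bullet> y = y \<bullet> x"
    and mul_add_left: "(x + y) \<bullet> z = x \<bullet> z + y \<bullet> z"
    and mul_scale_left: "(c *s x) \<bullet> y = c *s (x \<bullet> y)"

locale comm_baric_algebra = comm_nonassoc_algebra scale mul
  for scale :: "'k::field \<Rightarrow> 'a::ab_group_add \<Rightarrow> 'a" (infixr \<open>*s\<close> 75)
    and mul :: "'a \<Rightarrow> 'a \<Rightarrow> 'a" (infixl \<open>\<bullet>\<close> 70) +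
  fixes \<omega> :: "'a \<Rightarrow> 'k"
  assumes weight_add: "\<omega> (x + y) = \<omega> x + \<omega> y"
    and weight_scale: "\<omega> (c *s x) = c * \<omega> x"
    and weight_mul: "\<omega> (x \<bullet> y) = \<omega> x * \<omega> y"
    and weight_nonzero: "\<exists>x. \<omega> x \<noteq> 0"

text \<open>
  Principal powers: \<open>ppow mul x 1 = x\<close> and \<open>ppow mul x (k + 1) = mul x (ppow mul x k)\<close> for
  \<open>k \<ge> 1\<close>.  There is no unit; the value at exponent \<open>0\<close> is junk (namely \<open>x\<close>) and never used.
\<close>

definition ppow :: "('a \<Rightarrow> 'a \<Rightarrow> 'a) \<Rightarrow> 'a \<Rightarrow> nat \<Rightarrow> 'a" where
  "ppow mul x n = (mul x ^^ (n - 1)) x"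

lemma ppow_1: "ppow mul x 1 = x"
  by (simp add: ppow_def)

lemma ppow_Suc: "k \<ge> 1 \<Longrightarrow> ppow mul x (Suc k) = mul x (ppow mul x k)"
  by (cases k) (simp_all add: ppow_def)

definition train_identity ::
  "('k::field \<Rightarrow> 'a::ab_group_add \<Rightarrow> 'a) \<Rightarrow> ('a \<Rightarrow> 'a \<Rightarrow> 'a) \<Rightarrow> ('a \<Rightarrow> 'k) \<Rightarrow> nat \<Rightarrow> (nat \<Rightarrow> 'k) \<Rightarrow> bool"
where
  "train_identity scale mul \<omega> n \<gamma> \<longleftrightarrow>
     (\<forall>x. ppow mul x n + (\<Sum>i=1..n-1. scale (\<gamma> i * \<omega> x ^ i) (ppow mul x (n - i))) = 0)"

text \<open>Only \<open>\<gamma> 1, \<dots>, \<gamma> (n - 1)\<close> are relevant.\<close>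

definition train_equation ::
  "('k::field \<Rightarrow> 'a::ab_group_add \<Rightarrow> 'a) \<Rightarrow> ('a \<Rightarrow> 'a \<Rightarrow> 'a) \<Rightarrow> ('a \<Rightarrow> 'k) \<Rightarrow> nat \<Rightarrow> (nat \<Rightarrow> 'k) \<Rightarrow> bool"
where
  "train_equation scale mul \<omega> n \<gamma> \<longleftrightarrow>
     n \<ge> 2 \<and> train_identity scale mul \<omega> n \<gamma> \<and>
     (\<forall>m \<gamma>'. 2 \<le> m \<and> m < n \<longrightarrow> \<not> train_identity scale mul \<omega> m \<gamma>')"

definition principal_train_algebra ::
  "('k::field \<Rightarrow> 'a::ab_group_add \<Rightarrow> 'a) \<Rightarrow> ('a \<Rightarrow> 'a \<Rightarrow> 'a) \<Rightarrow> ('a \<Rightarrow> 'k) \<Rightarrow> nat \<Rightarrow> bool"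
where
  "principal_train_algebra scale mul \<omega> n \<longleftrightarrow> (\<exists>\<gamma>. train_equation scale mul \<omega> n \<gamma>)"

text \<open>
  The polynomial \<open>X ^ n + \<gamma> 1 * X ^ (n - 1) + \<dots> + \<gamma> (n - 1) * X\<close>, which has no constant term and
  whose coefficients are those of the train equation.
\<close>

definition train_poly :: "nat \<Rightarrow> (nat \<Rightarrow> 'k::field) \<Rightarrow> 'k poly" where
  "train_poly n \<gamma> = monom 1 n + (\<Sum>i=1..n-1. monom (\<gamma> i) (n - i))"

text \<open>
  For a polynomial \<open>P\<close> of degree \<open>n\<close> without constant term, this is
  \<open>\<omega>(x)\<^sup>n P(x / \<omega>(x))\<close>, homogenized so that it makes sense also when \<open>\<omega> x = 0\<close>.
\<close>

definition hom_eval ::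
  "('k::field \<Rightarrow> 'a::ab_group_add \<Rightarrow> 'a) \<Rightarrow> ('a \<Rightarrow> 'a \<Rightarrow> 'a) \<Rightarrow> ('a \<Rightarrow> 'k) \<Rightarrow> 'k poly \<Rightarrow> 'a \<Rightarrow> 'a"
where
  "hom_eval scale mul \<omega> P x =
     (\<Sum>k=1..degree P. scale (coeff P k * \<omega> x ^ (degree P - k)) (ppow mul x k))"

definition phi :: "'k::field \<Rightarrow> 'k poly \<Rightarrow> 'k poly" where
  "phi \<alpha> P = (monom 1 1 - [:\<alpha>:]) * P"

definition peirce_space ::
  "('k::field \<Rightarrow> 'a::ab_group_add \<Rightarrow> 'a) \<Rightarrow> ('a \<Rightarrow> 'a \<Rightarrow> 'a) \<Rightarrow> ('a \<Rightarrow> 'k) \<Rightarrow> 'a \<Rightarrow> 'k \<Rightarrow> 'a set"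
where
  "peirce_space scale mul \<omega> e \<alpha> = {x. \<omega> x = 0 \<and> mul e x = scale \<alpha> x}"

text \<open>
  The whole space is the internal direct sum of a list of subspaces.  The list may have repeated
  entries, and a repeated summand is then necessarily zero.
\<close>

definition is_direct_sum :: "'a::ab_group_add set list \<Rightarrow> bool" where
  "is_direct_sum Us \<longleftrightarrow> (\<forall>x. \<exists>!us. list_all2 (\<in>) us Us \<and> sum_list us = x)"

end

theory Submission
  imports Defs
begin

text \<open>
  Write the train polynomial as \<open>X Q\<close>.  Since \<open>x\<^sup>k\<^sup>+\<^sup>1\<close> is the \<open>k\<close>-th power of the multiplication
  operator \<open>L\<^sub>x\<close> applied to \<open>x\<close>, the train identity on elements of weight \<open>1\<close> reads
  \<open>Q(L\<^sub>x) x = 0\<close>, and this determines it on all elements (\<open>train_identity_iff_annihilates\<close>): the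
  nonzero weights follow by scaling, and weight \<open>0\<close> by density, as the field is infinite.  Taking
  weights gives \<open>Q(1) = 0\<close>, so \<open>Q = (X - 1) S\<close>, and it remains to show that every root \<open>\<alpha>\<close> of \<open>S\<close>
  is \<open>1/2\<close>, \<open>\<lambda>\<close> or its conjugate.

  Put \<open>R = Q / (X - \<alpha>)\<close>.  By minimality of the rank, \<open>R(L\<^sub>x) x\<close> is nonzero for some \<open>x\<close> of weight \<open>1\<close>.
  Along the line \<open>x(t) = e + t y\<close> through \<open>e\<close> and this \<open>x\<close>, the vector \<open>f(t) = R(L\<^sub>x\<^sub>(\<^sub>t\<^sub>)) x(t)\<close> is a
  polynomial in \<open>t\<close>; it satisfies \<open>x(t) f(t) = \<alpha> f(t)\<close>, because \<open>(X - \<alpha>) R = Q\<close>, and it has weight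
  \<open>R(1) = 0\<close>, because \<open>X - 1\<close> divides \<open>R\<close>.  Comparing lowest-order terms in \<open>t\<close>, the lowest
  nonvanishing coefficient \<open>z\<close> of \<open>f\<close> satisfies \<open>e z = \<alpha> z\<close> and has weight \<open>0\<close>
  (\<open>train_root_imp_eigenvalue\<close>).  So \<open>\<alpha>\<close> is an eigenvalue of \<open>L\<^sub>e\<close> on the kernel of the weight, and
  the Peirce decomposition with \<open>A\<^sub>0 = 0\<close> leaves only the three claimed values.

  The multiplicities are whatever the factorization of \<open>S\<close> over the algebraically closed field
  gives.  This treats \<open>\<alpha> = 0\<close> and \<open>\<alpha> = 1\<close> on the same footing as the other values, and also covers
  characteristic \<open>3\<close>, where \<open>\<lambda>\<close> and its conjugate are \<open>0\<close> and \<open>1\<close> in some order, and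
  characteristic \<open>23\<close>, where they coincide.
\<close>

section \<open>Polynomial curves\<close>

text \<open>
  Over a finite field, adding \<open>1\<close> to the product of all \<open>X - a\<close> gives a nonconstant polynomial
  without roots.
\<close>

lemma infinite_UNIV_alg_closed: "infinite (UNIV :: 'k::alg_closed_field set)"
proof
  assume fin: "finite (UNIV :: 'k set)"
  define q where "q = (\<Prod>a\<in>UNIV. [:-a, 1:] :: 'k poly)"
  have "degree q = card (UNIV :: 'k set)"
    unfolding q_def by (subst degree_prod_eq_sum_degree) auto
  hence "degree q > 0"
    using fin by (simp add: card_gt_0_iff)
  hence "degree (1 + q) > 0"
    by (simp add: degree_add_eq_right)
  then obtain x where "poly (1 + q) x = 0"
    using alg_closed_imp_poly_has_root by blast
  moreover have "poly q x = 0"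
    unfolding q_def poly_prod using fin by (auto intro!: prod_zero)
  ultimately show False
    by simp
qed

context comm_nonassoc_algebra
begin

text \<open>
  These are the maps \<open>t \<mapsto> \<Sum>i\<le>d. t\<^sup>i v\<^sub>i\<close>, generated in Horner form so that an induction can split off
  the constant term and divide the rest by \<open>t\<close>.
\<close>

inductive polynomial_curve :: "('k \<Rightarrow> 'a) \<Rightarrow> bool" where
  const: "polynomial_curve (\<lambda>_. v)"
| horner: "polynomial_curve f \<Longrightarrow> polynomial_curve (\<lambda>t. v + t *s f t)"

lemma polynomial_curve_scale_param:
  "polynomial_curve f \<Longrightarrow> polynomial_curve (\<lambda>t. t *s f t)"
  using horner[of f 0] by simp

lemma polynomial_curve_add:
  "polynomial_curve f \<Longrightarrow> polynomial_curve g \<Longrightarrow> polynomial_curve (\<lambda>t. f t + g t)"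
proof (induction f arbitrary: g rule: polynomial_curve.induct)
  case (const v)
  from this show ?case
  proof cases
    case (const w)
    then show ?thesis by (simp add: polynomial_curve.const)
  next
    case (horner h w)
    then show ?thesis
      using polynomial_curve.horner[of h "v + w"] by (simp add: add.assoc)
  qed
next
  case step: (horner f v)
  from step.prems show ?case
  proof cases
    case (const w)
    then show ?thesis
      using polynomial_curve.horner[OF step.hyps, of "v + w"] by (simp add: algebra_simps)
  next
    case (horner h w)
    then show ?thesis
      using polynomial_curve.horner[OF step.IH[OF horner(2)], of "v + w"]
      by (simp add: scale_right_distrib algebra_simps)
  qed
qed

lemma polynomial_curve_linear_image:
  assumes "polynomial_curve f" "\<And>x y. h (x + y) = h x + h y" "\<And>c x. h (c *s x) = c *s h x"
  shows "polynomial_curve (\<lambda>t. h (f t))"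
  using assms(1) by induction (simp_all add: assms(2,3) polynomial_curve.intros)

lemma polynomial_curve_scale:
  "polynomial_curve f \<Longrightarrow> polynomial_curve (\<lambda>t. c *s f t)"
  by (rule polynomial_curve_linear_image) (simp_all add: scale_right_distrib scale_left_commute)

lemma polynomial_curve_diff:
  "polynomial_curve f \<Longrightarrow> polynomial_curve g \<Longrightarrow> polynomial_curve (\<lambda>t. f t - g t)"
  using polynomial_curve_add[of f "\<lambda>t. (- 1) *s g t"] polynomial_curve_scale[of g "- 1"] by simp

lemma polynomial_curve_sum:
  "(\<And>i. i \<in> I \<Longrightarrow> polynomial_curve (f i)) \<Longrightarrow> polynomial_curve (\<lambda>t. \<Sum>i\<in>I. f i t)"
  by (induction I rule: infinite_finite_induct)
     (simp_all add: polynomial_curve.const polynomial_curve_add)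

lemma functional_of_polynomial_curve:
  assumes "polynomial_curve f" "\<And>x y. \<phi> (x + y) = \<phi> x + \<phi> y" "\<And>c x. \<phi> (c *s x) = c * \<phi> x"
  shows "\<exists>p. \<forall>t. \<phi> (f t) = poly p t"
  using assms(1)
proof induction
  case (const v)
  then show ?case by (intro exI[of _ "[:\<phi> v:]"]) simp
next
  case (horner f v)
  then obtain p where "\<forall>t. \<phi> (f t) = poly p t" by blast
  then show ?case by (intro exI[of _ "pCons (\<phi> v) p"]) (simp add: assms(2,3))
qed

text \<open>
  A linear functional that is nonzero at \<open>f s\<close> would turn \<open>f\<close> into a nonzero scalar polynomial with
  infinitely many roots.
\<close>

lemma polynomial_curve_eq_0:
  assumes f: "polynomial_curve f" and T: "infinite T" "\<And>t. t \<in> T \<Longrightarrow> f t = 0"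
  shows "f s = 0"
proof (rule ccontr)
  assume "f s \<noteq> 0"
  interpret pair: vector_space_pair scale "(*)"
    by unfold_locales (simp_all add: algebra_simps)
  obtain \<phi> where \<phi>: "Vector_Spaces.linear scale (*) \<phi>" "\<phi> (f s) = 1"
    using pair.linear_independent_extend[of "{f s}" "\<lambda>_. 1"] \<open>f s \<noteq> 0\<close> by auto
  interpret \<phi>: Vector_Spaces.linear scale "(*)" \<phi> by fact
  obtain p where p: "\<forall>t. \<phi> (f t) = poly p t"
    using functional_of_polynomial_curve[OF f \<phi>.add \<phi>.scale] ..
  have "T \<subseteq> {t. poly p t = 0}"
  proof
    fix t
    assume "t \<in> T"
    then have "\<phi> (f t) = 0"
      by (simp add: T(2) \<phi>.zero)
    with p show "t \<in> {t. poly p t = 0}"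
      by simp
  qed
  hence "p = 0"
    using T(1) poly_roots_finite finite_subset by blast
  thus False
    using p \<phi>(2) by simp
qed

end

section \<open>Polynomials in the multiplication operator of an element\<close>

context comm_nonassoc_algebra
begin

lemma mul_add_right: "x \<bullet> (y + z) = x \<bullet> y + x \<bullet> z"
  using mul_add_left[of y z x] by (simp add: mul_commute[of x])

lemma mul_scale_right: "x \<bullet> (c *s y) = c *s (x \<bullet> y)"
  using mul_scale_left[of c y x] by (simp add: mul_commute[of x])

lemma mul_zero_right: "x \<bullet> 0 = 0"
  using mul_scale_right[of x 0 0] by simp

lemma mul_sum_right: "x \<bullet> (\<Sum>i\<in>I. f i) = (\<Sum>i\<in>I. x \<bullet> f i)"
  by (induction I rule: infinite_finite_induct) (simp_all add: mul_zero_right mul_add_right)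

lemma polynomial_curve_mul:
  "polynomial_curve f \<Longrightarrow> polynomial_curve g \<Longrightarrow> polynomial_curve (\<lambda>t. f t \<bullet> g t)"
proof (induction f rule: polynomial_curve.induct)
  case (const v)
  show ?case
    by (rule polynomial_curve_linear_image[OF const]) (simp_all add: mul_add_right mul_scale_right)
next
  case (horner f v)
  have "polynomial_curve (\<lambda>t. v \<bullet> g t)"
    by (rule polynomial_curve_linear_image[OF horner.prems])
       (simp_all add: mul_add_right mul_scale_right)
  from polynomial_curve_add[OF this polynomial_curve_scale_param[OF horner.IH[OF horner.prems]]]
  show ?case
    by (simp only: mul_add_left mul_scale_left)
qed

lemma polynomial_curve_power_mul:
  "polynomial_curve f \<Longrightarrow> polynomial_curve (\<lambda>t. ((\<bullet>) (f t) ^^ k) (f t))"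
proof (induction k)
  case (Suc k)
  then have "polynomial_curve (\<lambda>t. f t \<bullet> ((\<bullet>) (f t) ^^ k) (f t))"
    by (intro polynomial_curve_mul[of f])
  then show ?case
    by simp
qed simp

text \<open>
  This is \<open>Q(L\<^sub>x) x\<close>, the value at \<open>x\<close> of \<open>X Q\<close> in principal powers.  Dropping the factor \<open>X\<close> lets the
  constant term of \<open>Q\<close> be arbitrary, so that multiplication by \<open>X - \<alpha>\<close> acts as \<open>L\<^sub>x - \<alpha>\<close>.
\<close>

definition power_eval :: "'k poly \<Rightarrow> 'a \<Rightarrow> 'a" where
  "power_eval Q x = (\<Sum>k\<le>degree Q. coeff Q k *s ((\<bullet>) x ^^ k) x)"

lemma power_eval_bound:
  "degree Q \<le> N \<Longrightarrow> power_eval Q x = (\<Sum>k\<le>N. coeff Q k *s ((\<bullet>) x ^^ k) x)"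
  unfolding power_eval_def
  by (rule sum.mono_neutral_left) (auto simp: coeff_eq_0)

lemma power_eval_add: "power_eval (P + Q) x = power_eval P x + power_eval Q x"
proof -
  define N where "N = max (degree P) (degree Q)"
  have "degree (P + Q) \<le> N" "degree P \<le> N" "degree Q \<le> N"
    by (simp_all add: N_def degree_add_le_max)
  then show ?thesis
    by (simp only: power_eval_bound coeff_add scale_left_distrib sum.distrib)
qed

lemma power_eval_smult: "power_eval (smult c Q) x = c *s power_eval Q x"
  using power_eval_bound[of "smult c Q" "degree Q" x]
  by (simp add: power_eval_def scale_sum_right)

lemma power_eval_diff: "power_eval (P - Q) x = power_eval P x - power_eval Q x"
  using power_eval_add[of "P - Q" Q x] by (simp add: algebra_simps)

lemma power_eval_pCons_0: "power_eval (pCons 0 Q) x = x \<bullet> power_eval Q x"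
proof -
  have "power_eval (pCons 0 Q) x
      = (\<Sum>k\<le>Suc (degree Q). coeff (pCons 0 Q) k *s ((\<bullet>) x ^^ k) x)"
    by (rule power_eval_bound) (simp add: degree_pCons_le)
  also have "\<dots> = (\<Sum>k\<le>degree Q. coeff Q k *s (x \<bullet> ((\<bullet>) x ^^ k) x))"
    by (subst sum.atMost_Suc_shift) simp
  finally show ?thesis
    by (simp add: power_eval_def mul_sum_right mul_scale_right)
qed

lemma power_eval_linear_factor:
  "power_eval ([:- \<alpha>, 1:] * Q) x = x \<bullet> power_eval Q x - \<alpha> *s power_eval Q x"
  by (simp add: power_eval_add power_eval_diff power_eval_smult power_eval_pCons_0)

lemma polynomial_curve_power_eval:
  "polynomial_curve f \<Longrightarrow> polynomial_curve (\<lambda>t. power_eval Q (f t))"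
  unfolding power_eval_def
  by (intro polynomial_curve_sum polynomial_curve_scale polynomial_curve_power_mul)

end

section \<open>Train identities as annihilating polynomials\<close>

context comm_baric_algebra
begin

lemma weight_sum: "\<omega> (\<Sum>i\<in>I. f i) = (\<Sum>i\<in>I. \<omega> (f i))"
proof -
  have "\<omega> 0 = 0"
    using weight_scale[of 0 0] by simp
  then show ?thesis
    by (induction I rule: infinite_finite_induct) (simp_all add: weight_add)
qed

lemma weight_diff: "\<omega> (x - y) = \<omega> x - \<omega> y"
  using weight_add[of "x - y" y] by (simp add: algebra_simps)

lemma weight_power_eval:
  assumes "\<omega> x = 1"
  shows "\<omega> (power_eval Q x) = poly Q 1"
proof -
  have "\<omega> (((\<bullet>) x ^^ k) x) = 1" for k
    by (induction k) (simp_all add: assms weight_mul)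
  then show ?thesis
    by (simp add: power_eval_def weight_sum weight_scale poly_altdef)
qed

definition annihilates :: "'k poly \<Rightarrow> bool" where
  "annihilates Q \<longleftrightarrow> (\<forall>x. \<omega> x = 1 \<longrightarrow> power_eval Q x = 0)"

lemma hom_eval_pCons_0:
  assumes "Q \<noteq> 0"
  shows "hom_eval scale mul \<omega> (pCons 0 Q) x
       = (\<Sum>k\<le>degree Q. (coeff Q k * \<omega> x ^ (degree Q - k)) *s ((\<bullet>) x ^^ k) x)"
  unfolding hom_eval_def using assms
  by (simp add: ppow_def atLeast0AtMost[symmetric] sum.shift_bounds_cl_Suc_ivl
      del: sum.cl_ivl_Suc)

lemma hom_eval_weight_1:
  assumes "Q \<noteq> 0" "\<omega> x = 1"
  shows "hom_eval scale mul \<omega> (pCons 0 Q) x = power_eval Q x"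
  by (simp add: hom_eval_pCons_0 assms power_eval_def)

lemma hom_eval_scale:
  assumes "Q \<noteq> 0"
  shows "hom_eval scale mul \<omega> (pCons 0 Q) (c *s x)
       = c ^ Suc (degree Q) *s hom_eval scale mul \<omega> (pCons 0 Q) x"
proof -
  have pow: "((\<bullet>) (c *s x) ^^ k) (c *s x) = c ^ Suc k *s ((\<bullet>) x ^^ k) x" for k
    by (induction k) (simp_all add: mul_scale_left mul_scale_right mult.assoc)
  have "c ^ (d - k) * c ^ k = c ^ d" if "k \<le> d" for k d
    using that by (simp add: power_add[symmetric])
  then show ?thesis
    unfolding hom_eval_pCons_0[OF assms] scale_sum_right pow weight_scale
    by (intro sum.cong refl) (simp add: power_mult_distrib mult_ac)
qed

text \<open>
  An element \<open>x\<close> of weight \<open>0\<close> lies on a line \<open>x + t u\<close> all of whose other points have nonzero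
  weight, where the homogenized expression vanishes by scaling; being polynomial in \<open>t\<close>, it then
  vanishes at \<open>t = 0\<close> too.
\<close>

lemma hom_eval_eq_0_iff_annihilates:
  assumes inf: "infinite (UNIV :: 'k set)" and Q: "Q \<noteq> 0"
  shows "(\<forall>x. hom_eval scale mul \<omega> (pCons 0 Q) x = 0) \<longleftrightarrow> annihilates Q"
proof
  assume "\<forall>x. hom_eval scale mul \<omega> (pCons 0 Q) x = 0"
  then show "annihilates Q"
    by (simp add: annihilates_def hom_eval_weight_1[OF Q, symmetric])
next
  let ?H = "hom_eval scale mul \<omega> (pCons 0 Q)"
  assume ann: "annihilates Q"
  have nonzero_weight: "?H x = 0" if "\<omega> x \<noteq> 0" for x
  proof -
    define u where "u = inverse (\<omega> x) *s x"
    have "\<omega> u = 1" "x = \<omega> x *s u"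
      using that by (simp_all add: u_def weight_scale)
    then show ?thesis
      using ann hom_eval_scale[OF Q, of "\<omega> x" u]
      by (simp add: annihilates_def hom_eval_weight_1[OF Q])
  qed
  show "\<forall>x. ?H x = 0"
  proof
    fix x
    show "?H x = 0"
    proof (cases "\<omega> x = 0")
      case True
      obtain u where u: "\<omega> u \<noteq> 0"
        using weight_nonzero by blast
      define f where "f = (\<lambda>t. x + t *s u)"
      have f: "polynomial_curve f"
        unfolding f_def by (intro polynomial_curve.intros)
      have \<omega>f: "\<omega> (f t) = t * \<omega> u" for t
        by (simp add: f_def weight_add weight_scale True)
      have scale_power: "polynomial_curve (\<lambda>t. (t ^ m) *s g t)" if "polynomial_curve g" for m g
        using that
      proof (induction m)
        case (Suc m)
        then show ?case
          using polynomial_curve_scale_param[of "\<lambda>t. (t ^ m) *s g t"] by simp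
      qed simp
      have "?H (f t) = (\<Sum>k\<le>degree Q. (coeff Q k * \<omega> u ^ (degree Q - k)) *s
              t ^ (degree Q - k) *s ((\<bullet>) (f t) ^^ k) (f t))" for t
        unfolding hom_eval_pCons_0[OF Q] \<omega>f by (simp add: power_mult_distrib mult_ac)
      moreover have "polynomial_curve \<dots>"
        by (intro polynomial_curve_sum polynomial_curve_scale scale_power
            polynomial_curve_power_mul f)
      ultimately have "polynomial_curve (\<lambda>t. ?H (f t))"
        by simp
      moreover have "infinite (UNIV - {0 :: 'k})"
        using inf by simp
      ultimately have "?H (f 0) = 0"
        by (rule polynomial_curve_eq_0) (use u in \<open>simp add: \<omega>f nonzero_weight\<close>)
      then show ?thesis
        by (simp add: f_def)
    qed (rule nonzero_weight)
  qed
qed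

end

lemma coeff_train_poly:
  "coeff (train_poly n \<gamma>) k = (if k = n then 1 else if 1 \<le> k \<and> k < n then \<gamma> (n - k) else 0)"
proof -
  have "coeff (\<Sum>i=1..n-1. monom (\<gamma> i) (n - i)) k = (\<Sum>i=1..n-1. if n - i = k then \<gamma> i else 0)"
    by (simp add: coeff_sum)
  also have "\<dots> = (if 1 \<le> k \<and> k < n then \<gamma> (n - k) else 0)"
  proof (cases "1 \<le> k \<and> k < n")
    case True
    then have "(\<Sum>i=1..n-1. if n - i = k then \<gamma> i else 0)
        = (\<Sum>i=1..n-1. if i = n - k then \<gamma> i else 0)"
      by (intro sum.cong) auto
    also have "\<dots> = \<gamma> (n - k)"
      using True by (subst sum.delta) auto
    finally show ?thesis using True by simp
  qed (auto intro!: sum.neutral)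
  finally show ?thesis
    by (auto simp: train_poly_def)
qed

lemma degree_train_poly: "degree (train_poly n \<gamma>) = n"
proof (rule antisym)
  show "degree (train_poly n \<gamma>) \<le> n"
    by (rule degree_le) (simp add: coeff_train_poly)
  show "n \<le> degree (train_poly n \<gamma>)"
    by (rule le_degree) (simp add: coeff_train_poly)
qed

context comm_baric_algebra
begin

lemma train_identity_iff_hom_eval:
  assumes "n \<ge> 1"
  shows "train_identity scale mul \<omega> n \<gamma> \<longleftrightarrow>
         (\<forall>x. hom_eval scale mul \<omega> (train_poly n \<gamma>) x = 0)"
proof -
  have "hom_eval scale mul \<omega> (train_poly n \<gamma>) x
      = ppow mul x n + (\<Sum>i=1..n-1. (\<gamma> i * \<omega> x ^ i) *s ppow mul x (n - i))" for x
  proof -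
    let ?c = "\<lambda>k. (coeff (train_poly n \<gamma>) k * \<omega> x ^ (n - k)) *s ppow mul x k"
    have "{1..n} = insert n {1..n-1}"
      using assms by auto
    then have "sum ?c {1..n} = ?c n + sum ?c {1..n-1}"
      using assms by simp
    moreover have "sum ?c {1..n-1} = (\<Sum>i=1..n-1. (\<gamma> i * \<omega> x ^ i) *s ppow mul x (n - i))"
      by (rule sum.reindex_bij_witness[of _ "\<lambda>i. n - i" "\<lambda>i. n - i"])
         (auto simp: coeff_train_poly)
    ultimately show ?thesis
      unfolding hom_eval_def degree_train_poly by (simp add: coeff_train_poly)
  qed
  then show ?thesis
    by (simp add: train_identity_def)
qed

lemma train_identity_iff_annihilates:
  assumes "infinite (UNIV :: 'k set)" "n \<ge> 1" "train_poly n \<gamma> = pCons 0 Q"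
  shows "train_identity scale mul \<omega> n \<gamma> \<longleftrightarrow> annihilates Q"
proof -
  have "Q \<noteq> 0"
    using assms(2) degree_train_poly[of n \<gamma>] unfolding assms(3) by auto
  with assms show ?thesis
    by (simp add: train_identity_iff_hom_eval hom_eval_eq_0_iff_annihilates)
qed

text \<open>
  Made monic, a nonzero \<open>R\<close> of positive degree would give a train identity of smaller degree.
  The rank is minimal only among degrees at least \<open>2\<close>, so a constant \<open>R\<close> is excluded separately:
  it would force every element of weight \<open>1\<close> to vanish.
\<close>

lemma train_equation_minimal:
  assumes inf: "infinite (UNIV :: 'k set)"
    and train: "train_equation scale mul \<omega> n \<gamma>"
    and R: "annihilates R" "Suc (degree R) < n"
  shows "R = 0"
proof (rule ccontr)
  assume "R \<noteq> 0"
  define m where "m = Suc (degree R)"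
  define S where "S = smult (inverse (lead_coeff R)) R"
  have S: "degree S = degree R" "lead_coeff S = 1"
    using \<open>R \<noteq> 0\<close> by (simp_all add: S_def)
  have ann: "annihilates S"
    using R(1) by (simp add: S_def annihilates_def power_eval_smult)
  show False
  proof (cases "degree R = 0")
    case True
    then have "power_eval S x = x" for x
      using S by (simp add: power_eval_def)
    moreover obtain u where "\<omega> u \<noteq> 0"
      using weight_nonzero by blast
    then have "\<omega> (inverse (\<omega> u) *s u) = 1"
      by (simp add: weight_scale)
    ultimately have "\<omega> 0 = 1"
      using ann by (metis annihilates_def)
    then show False
      using weight_scale[of 0 0] by simp
  next
    case False
    define \<delta> where "\<delta> = (\<lambda>i. coeff S (degree R - i))"
    have "train_poly m \<delta> = pCons 0 S"
    proof (rule poly_eqI)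
      fix k
      show "coeff (train_poly m \<delta>) k = coeff (pCons 0 S) k"
        using S by (cases k) (auto simp: coeff_train_poly m_def \<delta>_def coeff_eq_0 not_less)
    qed
    then have "train_identity scale mul \<omega> m \<delta>"
      using ann by (subst train_identity_iff_annihilates[OF inf]) (auto simp: m_def)
    moreover have "2 \<le> m" "m < n"
      using False R(2) by (auto simp: m_def)
    ultimately show False
      using train unfolding train_equation_def by blast
  qed
qed

section \<open>Roots of the train polynomial\<close>

text \<open>
  The eigenvector is the lowest nonvanishing coefficient of \<open>f\<close>.  If the constant term of \<open>f\<close> is
  nonzero, evaluating at \<open>t = 0\<close> shows that it will do.  Otherwise \<open>f(t) / t\<close> inherits all
  hypotheses for \<open>t \<noteq> 0\<close>, and by polynomiality for \<open>t = 0\<close>.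
\<close>

lemma eigenvector_from_curve:
  assumes inf: "infinite (UNIV :: 'k set)"
    and "polynomial_curve f"
    and "\<And>t. (e + t *s y) \<bullet> f t = \<alpha> *s f t"
    and "\<And>t. \<omega> (f t) = 0"
    and "\<exists>t. f t \<noteq> 0"
  shows "\<exists>z. z \<noteq> 0 \<and> \<omega> z = 0 \<and> e \<bullet> z = \<alpha> *s z"
  using assms(2-)
proof induction
  case (const v)
  from const(1)[of 0] const(2,3) show ?case
    by auto
next
  case (horner f v)
  show ?case
  proof (cases "v = 0")
    case False
    with horner.prems(1)[of 0] horner.prems(2)[of 0] show ?thesis
      by auto
  next
    case True
    have cofinite: "infinite (UNIV - {0 :: 'k})"
      using inf by simp
    let ?g = "\<lambda>t. (e + t *s y) \<bullet> f t - \<alpha> *s f t"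
    have g_curve: "polynomial_curve ?g"
      by (intro polynomial_curve_diff polynomial_curve_mul polynomial_curve_scale
          polynomial_curve.intros horner.hyps)
    have g_zero: "?g t = 0" if "t \<in> UNIV - {0}" for t
    proof -
      have "t *s ((e + t *s y) \<bullet> f t) = t *s (\<alpha> *s f t)"
        using horner.prems(1)[of t] True by (simp add: mul_scale_right mult.commute)
      then show ?thesis
        using that scale_left_imp_eq[of t] by (metis DiffE right_minus_eq singletonI)
    qed
    have "?g t = 0" for t
      by (rule polynomial_curve_eq_0[OF g_curve cofinite g_zero])
    moreover have "\<omega> (f t) = 0" for t
    proof -
      obtain u where "\<omega> u \<noteq> 0"
        using weight_nonzero by blast
      then have "u \<noteq> 0"
        using weight_scale[of 0 0] by auto
      have h_curve: "polynomial_curve (\<lambda>t. \<omega> (f t) *s u)"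
        by (rule polynomial_curve_linear_image[OF horner.hyps])
           (simp_all add: weight_add weight_scale scale_left_distrib)
      have h_zero: "\<omega> (f t) *s u = 0" if "t \<in> UNIV - {0}" for t
        using horner.prems(2)[of t] True that by (simp add: weight_scale)
      have "\<omega> (f t) *s u = 0"
        by (rule polynomial_curve_eq_0[OF h_curve cofinite h_zero])
      with \<open>u \<noteq> 0\<close> show ?thesis
        by simp
    qed
    moreover have "\<exists>t. f t \<noteq> 0"
      using horner.prems(3) True by auto
    ultimately show ?thesis
      by (intro horner.IH) auto
  qed
qed

text \<open>
  The extra factor \<open>X - 1\<close> survives in \<open>R = (X - 1) T\<close> and forces the weight of \<open>R(L\<^sub>x) x\<close> to be
  \<open>R(1) = 0\<close>, which keeps the eigenvector in the kernel of the weight.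
\<close>

lemma train_root_imp_eigenvalue:
  assumes inf: "infinite (UNIV :: 'k set)"
    and train: "train_equation scale mul \<omega> n \<gamma>"
    and factor: "train_poly n \<gamma> = pCons 0 ([:-1, 1:] * [:- \<alpha>, 1:] * T)"
    and e: "\<omega> e = 1"
  shows "\<exists>z. z \<noteq> 0 \<and> \<omega> z = 0 \<and> e \<bullet> z = \<alpha> *s z"
proof -
  define R where "R = [:-1, 1:] * T"
  have Q: "train_poly n \<gamma> = pCons 0 ([:- \<alpha>, 1:] * R)"
    using factor by (simp only: R_def mult_ac)
  have n: "n \<ge> 2" "train_identity scale mul \<omega> n \<gamma>"
    using train by (auto simp: train_equation_def)
  have "R \<noteq> 0"
    using degree_train_poly[of n \<gamma>] n unfolding Q by auto
  then have "degree ([:- \<alpha>, 1:] * R) = Suc (degree R)"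
    by (subst degree_mult_eq) auto
  moreover from this have "n = Suc (degree ([:- \<alpha>, 1:] * R))"
    using degree_train_poly[of n \<gamma>] unfolding Q by (metis degree_pCons_eq degree_0 nat.distinct(1))
  ultimately have "Suc (degree R) < n"
    by simp
  then obtain x where x: "\<omega> x = 1" "power_eval R x \<noteq> 0"
    using train_equation_minimal[OF inf train] \<open>R \<noteq> 0\<close> by (auto simp: annihilates_def)
  have ann: "annihilates ([:- \<alpha>, 1:] * R)"
    using train_identity_iff_annihilates[OF inf _ Q] n by simp
  define f where "f = (\<lambda>t. power_eval R (e + t *s (x - e)))"
  have weight: "\<omega> (e + t *s (x - e)) = 1" for t
    by (simp add: weight_add weight_scale weight_diff e x)
  show ?thesis
  proof (rule eigenvector_from_curve[OF inf])
    show "polynomial_curve f"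
      unfolding f_def by (intro polynomial_curve_power_eval polynomial_curve.intros)
    show "(e + t *s (x - e)) \<bullet> f t = \<alpha> *s f t" for t
      using ann weight[of t] power_eval_linear_factor[of \<alpha> R]
      by (simp add: annihilates_def f_def)
    show "\<omega> (f t) = 0" for t
      using weight[of t] by (simp add: f_def weight_power_eval R_def)
    show "\<exists>t. f t \<noteq> 0"
      using x(2) by (intro exI[of _ 1]) (simp add: f_def)
  qed
qed

text \<open>
  The leading terms of two train polynomials of the same degree cancel, so their difference is
  ruled out by minimality.
\<close>

lemma train_poly_unique:
  assumes inf: "infinite (UNIV :: 'k set)"
    and "train_equation scale mul \<omega> n \<gamma>" "train_equation scale mul \<omega> n \<delta>"
  shows "train_poly n \<gamma> = train_poly n \<delta>"
proof -
  have n: "n \<ge> 2"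
    using assms(2) by (simp add: train_equation_def)
  have shift: "\<exists>Q. train_poly n \<eta> = pCons 0 Q" for \<eta> :: "nat \<Rightarrow> 'k"
    by (cases "train_poly n \<eta>") (use n coeff_train_poly[of n \<eta> 0] in auto)
  obtain Q R where QR: "train_poly n \<gamma> = pCons 0 Q" "train_poly n \<delta> = pCons 0 R"
    using shift by blast
  have "annihilates Q" "annihilates R"
    using assms n QR train_identity_iff_annihilates[OF inf] by (auto simp: train_equation_def)
  then have "annihilates (Q - R)"
    by (simp add: annihilates_def power_eval_diff)
  moreover have "degree (Q - R) \<le> n - 2"
  proof (rule degree_le, intro allI impI)
    fix i
    assume "n - 2 < i"
    then have "coeff (train_poly n \<gamma>) (Suc i) = coeff (train_poly n \<delta>) (Suc i)"
      by (auto simp: coeff_train_poly)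
    then show "coeff (Q - R) i = 0"
      by (simp add: QR)
  qed
  ultimately have "Q - R = 0"
    using train_equation_minimal[OF inf assms(2)] n by force
  then show ?thesis
    by (simp add: QR)
qed

text \<open>
  The weight of \<open>Q(L\<^sub>e) e = 0\<close> is \<open>Q(1)\<close>, so one factor \<open>X - 1\<close> splits off; the eigenvalue result
  applies to the roots of what remains.
\<close>

lemma train_poly_cofactor:
  assumes inf: "infinite (UNIV :: 'k set)"
    and train: "train_equation scale mul \<omega> n \<gamma>"
    and e: "\<omega> e = 1"
  shows "\<exists>S. train_poly n \<gamma> = pCons 0 ([:-1, 1:] * S) \<and> lead_coeff S = 1 \<and> degree S = n - 2 \<and>
             (\<forall>\<alpha>. poly S \<alpha> = 0 \<longrightarrow> (\<exists>z. z \<noteq> 0 \<and> \<omega> z = 0 \<and> e \<bullet> z = \<alpha> *s z))"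
proof -
  have n: "n \<ge> 2" "train_identity scale mul \<omega> n \<gamma>"
    using train by (auto simp: train_equation_def)
  obtain Q where Q: "train_poly n \<gamma> = pCons 0 Q"
    by (cases "train_poly n \<gamma>") (use n coeff_train_poly[of n \<gamma> 0] in auto)
  have "annihilates Q"
    using train_identity_iff_annihilates[OF inf _ Q] n by simp
  then have "poly Q 1 = 0"
    using weight_power_eval[OF e, of Q] weight_scale[of 0 0] e by (simp add: annihilates_def)
  then obtain S where S: "Q = [:- 1, 1:] * S"
    by (auto simp: poly_eq_0_iff_dvd elim: dvdE)
  have "Q \<noteq> 0"
    using degree_train_poly[of n \<gamma>] n unfolding Q by auto
  then have degree_Q: "Suc (degree Q) = n"
    using degree_train_poly[of n \<gamma>] by (simp add: Q)
  have "S \<noteq> 0"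
    using \<open>Q \<noteq> 0\<close> S by auto
  then have degree_S: "degree S = n - 2"
    using degree_Q unfolding S by (subst (asm) degree_mult_eq) auto
  have "lead_coeff Q = 1"
    using coeff_train_poly[of n \<gamma> n] degree_Q by (auto simp: Q)
  then have lead_S: "lead_coeff S = 1"
    unfolding S lead_coeff_mult by simp
  have roots: "\<exists>z. z \<noteq> 0 \<and> \<omega> z = 0 \<and> e \<bullet> z = \<alpha> *s z" if "poly S \<alpha> = 0" for \<alpha>
  proof -
    obtain T where "S = [:- \<alpha>, 1:] * T"
      using \<open>poly S \<alpha> = 0\<close> by (auto simp: poly_eq_0_iff_dvd elim: dvdE)
    then have "train_poly n \<gamma> = pCons 0 ([:-1, 1:] * [:- \<alpha>, 1:] * T)"
      by (simp only: Q S mult.assoc)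
    then show ?thesis
      by (rule train_root_imp_eigenvalue[OF inf train _ e])
  qed
  show ?thesis
    by (intro exI[of _ S] conjI allI impI lead_S degree_S roots) (simp only: Q S)
qed

section \<open>Peirce decompositions without zero component\<close>

text \<open>
  All summands but the span of \<open>e\<close> lie in the kernel of the weight, so \<open>e\<close> has nonzero, hence unit,
  weight, and an eigenvector in the kernel has no component along \<open>e\<close>.  By uniqueness of the
  decomposition its components in the Peirce spaces are themselves eigenvectors for \<open>\<alpha>\<close>.
\<close>

lemma peirce_idempotent_and_eigenvalues:
  fixes e :: 'a and a b c :: 'k
  defines "V \<equiv> peirce_space scale mul \<omega> e"
  assumes sum: "is_direct_sum [span {e}, V 0, V a, V b, V c]"
    and V0: "V 0 = {0}"
    and idempotent: "e \<bullet> e = e"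
  shows weight_idempotent: "\<omega> e = 1"
    and eigenvalue_cases: "z \<noteq> 0 \<Longrightarrow> \<omega> z = 0 \<Longrightarrow> e \<bullet> z = \<alpha> *s z \<Longrightarrow> \<alpha> \<in> {a, b, c}"
proof -
  let ?Us = "[span {e}, V 0, V a, V b, V c]"
  have decomposition: "\<exists>d y\<^sub>1 y\<^sub>2 y\<^sub>3. y\<^sub>1 \<in> V a \<and> y\<^sub>2 \<in> V b \<and> y\<^sub>3 \<in> V c \<and>
      x = d *s e + y\<^sub>1 + y\<^sub>2 + y\<^sub>3" for x
  proof -
    obtain us where us: "list_all2 (\<in>) us ?Us" "sum_list us = x"
      using sum unfolding is_direct_sum_def by meson
    then show ?thesis
      by (auto simp: list_all2_Cons2 V0 span_singleton add.assoc) blast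
  qed
  have V_D: "\<omega> v = 0" "e \<bullet> v = \<beta> *s v" if "v \<in> V \<beta>" for v \<beta>
    using that by (simp_all add: V_def peirce_space_def)
  show \<omega>e: "\<omega> e = 1"
  proof -
    obtain x where "\<omega> x \<noteq> 0"
      using weight_nonzero by blast
    moreover obtain d y\<^sub>1 y\<^sub>2 y\<^sub>3 where "y\<^sub>1 \<in> V a" "y\<^sub>2 \<in> V b" "y\<^sub>3 \<in> V c"
        "x = d *s e + y\<^sub>1 + y\<^sub>2 + y\<^sub>3"
      using decomposition by blast
    ultimately have "\<omega> e \<noteq> 0"
      by (auto simp: weight_add weight_scale V_D(1))
    moreover have "\<omega> e * \<omega> e = \<omega> e"
      using weight_mul[of e e] idempotent by simp
    ultimately show ?thesis
      by simp
  qed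
  assume z: "z \<noteq> 0" "\<omega> z = 0" "e \<bullet> z = \<alpha> *s z"
  show "\<alpha> \<in> {a, b, c}"
  proof (rule ccontr)
    assume \<alpha>: "\<alpha> \<notin> {a, b, c}"
    obtain d y\<^sub>1 y\<^sub>2 y\<^sub>3 where y: "y\<^sub>1 \<in> V a" "y\<^sub>2 \<in> V b" "y\<^sub>3 \<in> V c"
        and z_eq: "z = d *s e + y\<^sub>1 + y\<^sub>2 + y\<^sub>3"
      using decomposition by blast
    have "\<omega> z = d"
      using y by (simp add: z_eq weight_add weight_scale V_D(1) \<omega>e)
    then have z_sum: "z = y\<^sub>1 + y\<^sub>2 + y\<^sub>3"
      using z(2) z_eq by simp
    have V_scale: "k *s v \<in> V \<beta>" if "v \<in> V \<beta>" for k \<beta> v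
      using that
      by (simp add: V_def peirce_space_def weight_scale mul_scale_right scale_left_commute[of k \<beta>])
    have V_zero: "0 \<in> V \<beta>" for \<beta>
      using weight_scale[of 0 0] by (simp add: V_def peirce_space_def mul_zero_right)
    \<comment> \<open>Subtracting \<open>\<alpha> z\<close> from \<open>e z\<close> gives a decomposition of \<open>0\<close>, whose components must vanish.\<close>
    let ?us = "[0, 0, (a - \<alpha>) *s y\<^sub>1, (b - \<alpha>) *s y\<^sub>2, (c - \<alpha>) *s y\<^sub>3]"
    let ?zs = "[0, 0, 0, 0, 0] :: 'a list"
    have "e \<bullet> z = a *s y\<^sub>1 + b *s y\<^sub>2 + c *s y\<^sub>3"
      unfolding z_sum mul_add_right by (simp only: V_D(2)[OF y(1)] V_D(2)[OF y(2)] V_D(2)[OF y(3)])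
    then have "sum_list ?us = e \<bullet> z - \<alpha> *s z"
      unfolding z_sum by (simp add: scale_right_distrib scale_left_diff_distrib)
    then have "sum_list ?us = sum_list ?zs"
      using z(3) by simp
    moreover have "list_all2 (\<in>) ?us ?Us" "list_all2 (\<in>) ?zs ?Us"
      using y by (simp_all add: V_scale V_zero span_zero)
    ultimately have "?us = ?zs"
      using sum unfolding is_direct_sum_def by metis
    then have "(a - \<alpha>) *s y\<^sub>1 = 0" "(b - \<alpha>) *s y\<^sub>2 = 0" "(c - \<alpha>) *s y\<^sub>3 = 0"
      by (simp_all only: list.inject)
    moreover have "a - \<alpha> \<noteq> 0" "b - \<alpha> \<noteq> 0" "c - \<alpha> \<noteq> 0"
      using \<alpha> by (simp_all only: right_minus_eq) auto
    ultimately have "y\<^sub>1 = 0" "y\<^sub>2 = 0" "y\<^sub>3 = 0"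
      by (simp_all only: scale_eq_0_iff simp_thms)
    then show False
      using z(1) z_sum by simp
  qed
qed

end

section \<open>Factorization over an algebraically closed field\<close>

lemma monic_poly_product_of_three_roots:
  fixes S :: "'k::alg_closed_field poly"
  assumes "lead_coeff S = 1" "\<And>\<alpha>. poly S \<alpha> = 0 \<Longrightarrow> \<alpha> \<in> {a, b, c}"
  shows "\<exists>r s t. r + s + t = degree S \<and> S = [:-c, 1:] ^ t * ([:-b, 1:] ^ s * [:-a, 1:] ^ r)"
  using assms
proof (induction "degree S" arbitrary: S)
  case 0
  then have "S = 1"
    using degree_0_id[of S] by (simp add: one_pCons)
  then show ?case
    by (intro exI[of _ 0]) simp
next
  case (Suc d)
  then obtain \<alpha> where \<alpha>: "poly S \<alpha> = 0"
    using alg_closed_imp_poly_has_root[of S] by auto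
  then obtain T where T: "S = [:- \<alpha>, 1:] * T"
    by (auto simp: poly_eq_0_iff_dvd elim: dvdE)
  have "T \<noteq> 0"
    using Suc.prems(1) T by auto
  then have d: "degree S = Suc (degree T)"
    unfolding T by (subst degree_mult_eq) auto
  have lead: "lead_coeff T = 1"
    using Suc.prems(1) unfolding T lead_coeff_mult by simp
  have roots: "\<beta> \<in> {a, b, c}" if "poly T \<beta> = 0" for \<beta>
    using Suc.prems(2)[of \<beta>] that by (simp add: T)
  obtain r s t where rst: "r + s + t = degree T"
      "T = [:-c, 1:] ^ t * ([:-b, 1:] ^ s * [:-a, 1:] ^ r)"
    using Suc.hyps(1)[of T] Suc.hyps(2) d lead roots by auto
  from Suc.prems(2)[OF \<alpha>] consider "\<alpha> = a" | "\<alpha> = b" | "\<alpha> = c"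
    by blast
  then show ?case
  proof cases
    case 1
    have "Suc r + s + t = degree S" "S = [:-c, 1:] ^ t * ([:-b, 1:] ^ s * [:-a, 1:] ^ Suc r)"
      using rst(1) d by (simp, unfold T rst(2) 1, simp only: power_Suc mult_ac)
    then show ?thesis by blast
  next
    case 2
    have "r + Suc s + t = degree S" "S = [:-c, 1:] ^ t * ([:-b, 1:] ^ Suc s * [:-a, 1:] ^ r)"
      using rst(1) d by (simp, unfold T rst(2) 2, simp only: power_Suc mult_ac)
    then show ?thesis by blast
  next
    case 3
    have "r + s + Suc t = degree S" "S = [:-c, 1:] ^ Suc t * ([:-b, 1:] ^ s * [:-a, 1:] ^ r)"
      using rst(1) d by (simp, unfold T rst(2) 3, simp only: power_Suc mult_ac)
    then show ?thesis by blast
  qed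
qed

lemma phi_funpow: "(phi \<alpha> ^^ m) P = [:- \<alpha>, 1:] ^ m * P"
proof (induction m)
  case (Suc m)
  have "monom 1 1 - [:\<alpha>:] = [:- \<alpha>, 1:]"
    by (simp add: monom_altdef)
  with Suc show ?case
    by (simp only: funpow.simps o_apply phi_def power_Suc mult.assoc)
qed simp

theorem theorem5p8:
  fixes scale :: "'k::alg_closed_field \<Rightarrow> 'a::ab_group_add \<Rightarrow> 'a" (infixr \<open>*s\<close> 75)
    and mul :: "'a \<Rightarrow> 'a \<Rightarrow> 'a" (infixl \<open>\<bullet>\<close> 70)
    and \<omega> :: "'a \<Rightarrow> 'k"
    and e :: 'a
    and i23 lam lam_bar :: 'k
    and \<mu> :: "'k poly"
    and n :: nat
  assumes char: "CHAR('k) \<noteq> 2"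
    and baric: "comm_baric_algebra scale mul \<omega>"
    and identity: "\<And>x. 2 *s (ppow mul x 2 \<bullet> ppow mul x 4) =
                        (\<omega> x ^ 2) *s ppow mul x 4 + (\<omega> x ^ 4) *s ppow mul x 2"
    and i23: "i23 ^ 2 = - 23"
    and lam: "lam = (- 1 - i23) / 4"
    and lam_bar: "lam_bar = (- 1 + i23) / 4"
    and idempotent: "e \<noteq> 0" "e \<bullet> e = e"
    and peirce: "is_direct_sum
                   [module.span scale {e},
                    peirce_space scale mul \<omega> e 0,
                    peirce_space scale mul \<omega> e (1 / 2),
                    peirce_space scale mul \<omega> e lam,
                    peirce_space scale mul \<omega> e lam_bar]"
    and A0: "peirce_space scale mul \<omega> e 0 = {0}"
    and mu: "\<mu> = monom 1 2 - monom 1 1"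
    and rank: "n \<ge> 4" "principal_train_algebra scale mul \<omega> n"
  shows "\<exists>r s t :: nat. r + s + t = n - 2 \<and>
           (let P = ((phi lam_bar ^^ t) \<circ> (phi lam ^^ s) \<circ> (phi (1 / 2) ^^ r)) \<mu> in
              (\<forall>\<gamma>. train_equation scale mul \<omega> n \<gamma> \<longrightarrow> train_poly n \<gamma> = P) \<and>
              (\<forall>x. hom_eval scale mul \<omega> P x = 0))"
proof -
  note inf = infinite_UNIV_alg_closed[where 'k = 'k]
  note \<omega>e = comm_baric_algebra.weight_idempotent[OF baric peirce A0 idempotent(2)]
  note eigenvalue = comm_baric_algebra.eigenvalue_cases[OF baric peirce A0 idempotent(2)]
  obtain \<gamma> where train: "train_equation scale mul \<omega> n \<gamma>"
    using rank(2) unfolding principal_train_algebra_def ..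
  obtain S where S: "train_poly n \<gamma> = pCons 0 ([:- 1, 1:] * S)" "lead_coeff S = 1" "degree S = n - 2"
    and roots: "\<And>\<alpha>. poly S \<alpha> = 0 \<Longrightarrow> \<exists>z. z \<noteq> 0 \<and> \<omega> z = 0 \<and> e \<bullet> z = \<alpha> *s z"
    using comm_baric_algebra.train_poly_cofactor[OF baric inf train \<omega>e] by metis
  have "\<alpha> \<in> {1 / 2, lam, lam_bar}" if "poly S \<alpha> = 0" for \<alpha>
    using roots[OF that] eigenvalue by metis
  with S(2) obtain r s t where rst: "r + s + t = degree S"
      "S = [:- lam_bar, 1:] ^ t * ([:- lam, 1:] ^ s * [:- (1 / 2), 1:] ^ r)"
    using monic_poly_product_of_three_roots[of S "1 / 2" lam lam_bar] by metis
  have shift: "A * pCons 0 B = pCons 0 (A * B)" for A B :: "'k poly"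
    by simp
  have "\<mu> = pCons 0 [:- 1, 1:]"
    unfolding mu by (simp add: monom_altdef power2_eq_square)
  then have P: "((phi lam_bar ^^ t) \<circ> (phi lam ^^ s) \<circ> (phi (1 / 2) ^^ r)) \<mu> = train_poly n \<gamma>"
    unfolding o_apply phi_funpow S(1) rst(2) by (simp only: shift) (simp only: mult_ac)
  have "r + s + t = n - 2"
    using rst(1) S(3) by simp
  moreover have "\<forall>\<delta>. train_equation scale mul \<omega> n \<delta> \<longrightarrow> train_poly n \<delta> = train_poly n \<gamma>"
    using comm_baric_algebra.train_poly_unique[OF baric inf _ train] by blast
  moreover have "\<forall>x. hom_eval scale mul \<omega> (train_poly n \<gamma>) x = 0"
    using comm_baric_algebra.train_identity_iff_hom_eval[OF baric, of n \<gamma>] train rank(1)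
    by (simp add: train_equation_def)
  ultimately show ?thesis
    unfolding Let_def by (intro exI[of _ r] exI[of _ s] exI[of _ t]) (simp only: P simp_thms)
qed

end
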